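(* There exists a constant $c>0$ such that the following holds. Let $k:\mathbb N\to\mathbb N$, $p:\mathbb N\to(0,1)$ and let $\{\mathcal G^k(N,p)\}_N$ be any $k$-wise independent random graph. Then $\mathcal G^k(N,p)$ is connected with probability tending to $1$ as $N\to\infty$ whenever either (1) $k\ge 4$ and $p(N)\sqrt N\to\infty$; or (2) $k(N)\ge 4\log N$ and $p(N)\ge \frac{c\ln N}{N}$.
   Context: A $k$-wise independent random graph $\{\mathcal G^k(N,p)\}_N$ is a sequence, indexed by $N$, of probability distributions on simple undirected graphs with vertex set $\{1,\dots,N\}$ such that every potential edge appears with probability $p(N)$ and the indicator random variables of the appearance of any $k(N)$ potential edges are mutually independent. $\log$ is the base-2 logarithm, $\ln$ the natural logarithm. *)

theory Defs
  imports "HOL-Probability.Probability"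
begin

text \<open>A simple undirected graph on the vertex set \<open>{1..N}\<close> is represented by its edge set,
  a subset of \<open>potential_edges N\<close>.\<close>

definition potential_edges :: "nat \<Rightarrow> nat set set" where
  "potential_edges N = {e. e \<subseteq> {1..N} \<and> card e = 2}"

definition connected_graph :: "nat \<Rightarrow> nat set set \<Rightarrow> bool" where
  "connected_graph N E \<longleftrightarrow>
     (\<forall>u\<in>{1..N}. \<forall>v\<in>{1..N}. (u, v) \<in> {(x, y). {x, y} \<in> E}\<^sup>*)"

text \<open>Independence is required of all sets of at most \<open>k N\<close> potential edges. If there are at
  least \<open>k N\<close> potential edges, this is the same as requiring it of all sets of exactly \<open>k N\<close>
  of them; if there are fewer, it means that all edges are mutually independent, whereas the
  version with exactly \<open>k N\<close> edges would be vacuous.\<close>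

definition kwise_independent_random_graph ::
    "(nat \<Rightarrow> nat) \<Rightarrow> (nat \<Rightarrow> real) \<Rightarrow> (nat \<Rightarrow> nat set set pmf) \<Rightarrow> bool" where
  "kwise_independent_random_graph k p \<G> \<longleftrightarrow>
     (\<forall>N. set_pmf (\<G> N) \<subseteq> Pow (potential_edges N) \<and>
          (\<forall>e\<in>potential_edges N. measure_pmf.prob (\<G> N) {E. e \<in> E} = p N) \<and>
          (\<forall>S. S \<subseteq> potential_edges N \<and> card S \<le> k N \<longrightarrow>
             prob_space.indep_vars (measure_pmf (\<G> N)) (\<lambda>_. borel)
               (\<lambda>e E. indicator E e :: real) S))"

end

theory Submission
  imports Defs
begin

text \<open>Let \<open>A\<close> be the adjacency matrix with \<open>p\<close> subtracted off the diagonal, and let \<open>m \<le> k\<close> be a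
  power of two. If the graph is disconnected, it has a union \<open>S\<close> of components with
  \<open>1 \<le> |S| \<le> N / 2\<close>. Either some row sum of \<open>A\<close> is below \<open>- N p / 4\<close>, or, as no edge leaves \<open>S\<close>,
  the Rayleigh quotient of \<open>A\<close> at the indicator vector of \<open>S\<close> is at least \<open>N p / 4\<close>; then the trace
  of \<open>A ^ m\<close> is at least \<open>(N p / 4) ^ m\<close> by iterating the Cauchy-Schwarz inequality. The expectations
  of the trace and of the \<open>m\<close>-th powers of the row sums are sums over walks and stars with \<open>m\<close> edges,
  and only those in which every edge is repeated contribute. Counting them step by step bounds
  each of the \<open>2 N\<close> expectations by \<open>(2 sqrt (N p m)) ^ m\<close>. Markov's inequality then gives
  disconnectedness a probability of at most \<open>2 N (64 m / (N p)) ^ (m / 2)\<close>. Take \<open>m = 4\<close> in the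
  first case and \<open>2 log N < m \<le> 4 log N\<close> in the second.\<close>

section \<open>Quadratic forms and traces of powers\<close>

definition quad_form :: "'a set \<Rightarrow> ('a \<Rightarrow> 'a \<Rightarrow> real) \<Rightarrow> ('a \<Rightarrow> real) \<Rightarrow> real" where
  "quad_form V A x = (\<Sum>u\<in>V. \<Sum>v\<in>V. x u * A u v * x v)"

definition mat_square :: "'a set \<Rightarrow> ('a \<Rightarrow> 'a \<Rightarrow> real) \<Rightarrow> 'a \<Rightarrow> 'a \<Rightarrow> real" where
  "mat_square V A u v = (\<Sum>w\<in>V. A u w * A w v)"

fun mat_power :: "'a set \<Rightarrow> ('a \<Rightarrow> 'a \<Rightarrow> real) \<Rightarrow> nat \<Rightarrow> 'a \<Rightarrow> 'a \<Rightarrow> real" where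
  "mat_power V A 0 u v = of_bool (u = v)"
| "mat_power V A (Suc m) u v = (\<Sum>w\<in>V. mat_power V A m u w * A w v)"

lemma mat_power_mat_square:
  "mat_power V (mat_square V A) m u v = mat_power V A (2 * m) u v"
proof (induction m arbitrary: v)
  case (Suc m)
  have "mat_power V (mat_square V A) (Suc m) u v
      = (\<Sum>w\<in>V. \<Sum>y\<in>V. mat_power V A (2 * m) u w * A w y * A y v)"
    by (simp add: Suc.IH) (simp add: mat_square_def sum_distrib_left mult.assoc)
  also have "\<dots> = (\<Sum>y\<in>V. \<Sum>w\<in>V. mat_power V A (2 * m) u w * A w y * A y v)"
    by (rule sum.swap)
  also have "\<dots> = mat_power V A (2 * Suc m) u v"
    by (simp add: sum_distrib_right)
  finally show ?case .
qed simp

lemma mat_square_symmetric: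
  assumes "\<And>u v. A u v = A v u"
  shows "mat_square V A u v = mat_square V A v u"
  unfolding mat_square_def by (simp add: assms[of u] assms[of _ v] mult.commute)

lemma quad_form_le_row_norms:
  "(quad_form V A x)\<^sup>2 \<le> (\<Sum>u\<in>V. (x u)\<^sup>2) * (\<Sum>u\<in>V. (\<Sum>v\<in>V. A u v * x v)\<^sup>2)"
proof -
  have "quad_form V A x = (\<Sum>u\<in>V. x u * (\<Sum>v\<in>V. A u v * x v))"
    by (simp add: quad_form_def sum_distrib_left mult.assoc)
  then show ?thesis
    using Cauchy_Schwarz_ineq_sum[of x "\<lambda>u. \<Sum>v\<in>V. A u v * x v" V] by simp
qed

text \<open>Cauchy-Schwarz leaves the squared norm of \<open>A x\<close>, which for symmetric
  \<open>A\<close> is the quadratic form of the square of \<open>A\<close>.\<close>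

lemma quad_form_square_le:
  assumes sym: "\<And>u v. A u v = A v u"
  shows "(quad_form V A x)\<^sup>2 \<le> (\<Sum>u\<in>V. (x u)\<^sup>2) * quad_form V (mat_square V A) x"
proof -
  have "(\<Sum>u\<in>V. (\<Sum>v\<in>V. A u v * x v)\<^sup>2)
      = (\<Sum>u\<in>V. \<Sum>v\<in>V. \<Sum>w\<in>V. x v * (A v u * A u w) * x w)"
    by (simp add: power2_eq_square sum_product sym mult_ac)
  also have "\<dots> = (\<Sum>v\<in>V. \<Sum>u\<in>V. \<Sum>w\<in>V. x v * (A v u * A u w) * x w)"
    by (rule sum.swap)
  also have "\<dots> = (\<Sum>v\<in>V. \<Sum>w\<in>V. \<Sum>u\<in>V. x v * (A v u * A u w) * x w)"
    by (intro sum.cong refl sum.swap)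
  also have "\<dots> = quad_form V (mat_square V A) x"
    by (simp add: quad_form_def mat_square_def sum_distrib_left sum_distrib_right)
  finally show ?thesis
    using quad_form_le_row_norms[of V A x] by simp
qed

text \<open>Cauchy-Schwarz in every row bounds the squared norm of \<open>A x\<close> by that of
  \<open>x\<close> times the sum of all squared entries; by symmetry this sum is the trace of the
  square.\<close>

lemma quad_form_square_le_trace:
  assumes sym: "\<And>u v. A u v = A v u"
  shows "(quad_form V A x)\<^sup>2 \<le> (\<Sum>u\<in>V. (x u)\<^sup>2)\<^sup>2 * (\<Sum>u\<in>V. mat_square V A u u)"
proof -
  have "(\<Sum>u\<in>V. (\<Sum>v\<in>V. A u v * x v)\<^sup>2)
      \<le> (\<Sum>u\<in>V. (\<Sum>v\<in>V. (A u v)\<^sup>2) * (\<Sum>v\<in>V. (x v)\<^sup>2))"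
    by (intro sum_mono Cauchy_Schwarz_ineq_sum)
  also have "\<dots> = (\<Sum>u\<in>V. (x u)\<^sup>2) * (\<Sum>u\<in>V. mat_square V A u u)"
  proof -
    have "mat_square V A u u = (\<Sum>v\<in>V. (A u v)\<^sup>2)" for u
      unfolding mat_square_def power2_eq_square by (intro sum.cong refl) (metis sym)
    then show ?thesis by (simp add: sum_distrib_left mult.commute)
  qed
  finally have "(\<Sum>u\<in>V. (x u)\<^sup>2) * (\<Sum>u\<in>V. (\<Sum>v\<in>V. A u v * x v)\<^sup>2)
      \<le> (\<Sum>u\<in>V. (x u)\<^sup>2) * ((\<Sum>u\<in>V. (x u)\<^sup>2) * (\<Sum>u\<in>V. mat_square V A u u))"
    by (intro mult_left_mono sum_nonneg) auto
  then show ?thesis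
    using quad_form_le_row_norms[of V A x] by (simp add: power2_eq_square mult.assoc)
qed

text \<open>Induction on \<open>r\<close> for all symmetric matrices at once:
  \<open>quad_form_square_le\<close> passes from \<open>A\<close> to its square, which is again
  symmetric, and halves the exponent. The trace bound is the base case. This takes the place of an
  argument with eigenvalues.\<close>

lemma quad_form_power_le_trace:
  assumes sym: "\<And>u v. A u v = A v u"
  shows "(quad_form V A x) ^ (2 ^ Suc r)
     \<le> (\<Sum>u\<in>V. (x u)\<^sup>2) ^ (2 ^ Suc r) * (\<Sum>u\<in>V. mat_power V A (2 ^ Suc r) u u)"
  using sym
proof (induction r arbitrary: A)
  case 0
  have "mat_power V A 2 u u = mat_square V A u u" if "u \<in> V" for u
    using mat_power_mat_square[of V A 1 u u] by (cases "finite V") (auto simp: that mat_square_def of_bool_def if_distrib if_distribR sum.delta cong: if_cong)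
  then show ?case using quad_form_square_le_trace[of A V x] 0 by simp
next
  case (Suc r)
  let ?n = "\<Sum>u\<in>V. (x u)\<^sup>2" and ?B = "mat_square V A" and ?m = "2 ^ Suc r :: nat"
  have "(quad_form V A x) ^ (2 ^ Suc (Suc r)) = ((quad_form V A x)\<^sup>2) ^ ?m"
    by (simp add: power_mult[symmetric])
  also have "\<dots> \<le> (?n * quad_form V ?B x) ^ ?m"
    by (intro power_mono quad_form_square_le Suc.prems) simp
  also have "\<dots> = ?n ^ ?m * (quad_form V ?B x) ^ ?m"
    by (rule power_mult_distrib)
  also have "\<dots> \<le> ?n ^ ?m * (?n ^ ?m * (\<Sum>u\<in>V. mat_power V ?B ?m u u))"
    by (intro mult_left_mono Suc.IH mat_square_symmetric Suc.prems zero_le_power sum_nonneg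
        zero_le_power2)
  also have "\<dots> = ?n ^ (2 ^ Suc (Suc r)) * (\<Sum>u\<in>V. mat_power V A (2 ^ Suc (Suc r)) u u)"
    by (simp add: mat_power_mat_square power_add[symmetric] mult.assoc[symmetric] del: mat_power.simps)
  finally show ?case .
qed

text \<open>At the all-ones vector, \<open>quad_form_power_le_trace\<close> bounds an even power by
  a positive multiple of the trace.\<close>

lemma trace_mat_power_nonneg:
  assumes sym: "\<And>u v. A u v = A v u" and V: "finite V"
  shows "0 \<le> (\<Sum>u\<in>V. mat_power V A (2 ^ Suc r) u u)"
proof (cases "V = {}")
  case False
  have "0 \<le> (quad_form V A (\<lambda>_. 1)) ^ (2 ^ Suc r)"
    by (intro zero_le_even_power) simp
  also have "\<dots> \<le> real (card V) ^ (2 ^ Suc r) * (\<Sum>u\<in>V. mat_power V A (2 ^ Suc r) u u)"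
    using quad_form_power_le_trace[of A V "\<lambda>_. 1" r] sym by simp
  finally have "0 \<le> real (card V) ^ (2 ^ Suc r) * (\<Sum>u\<in>V. mat_power V A (2 ^ Suc r) u u)" .
  moreover have "real (card V) ^ (2 ^ Suc r) > 0"
    using False V by (simp add: card_gt_0_iff)
  ultimately show ?thesis
    using zero_le_mult_iff by (metis not_le)
qed simp

section \<open>Sequences of edges\<close>

definition tuples :: "'a set \<Rightarrow> nat \<Rightarrow> 'a list set" where
  "tuples V m = {xs. set xs \<subseteq> V \<and> length xs = m}"

lemma tuples_0: "tuples V 0 = {[]}"
  by (auto simp: tuples_def)

lemma sum_tuples_Suc:
  "(\<Sum>xs\<in>tuples V (Suc m). f xs) = (\<Sum>xs\<in>tuples V m. \<Sum>w\<in>V. f (w # xs))"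
proof -
  have "tuples V (Suc m) = (\<lambda>(xs, w). w # xs) ` (tuples V m \<times> V)"
    by (auto simp: tuples_def length_Suc_conv image_iff)
  moreover have "inj_on (\<lambda>(xs, w). w # xs) (tuples V m \<times> V)"
    by (auto simp: inj_on_def)
  ultimately show ?thesis
    by (simp add: sum.reindex sum.cartesian_product split_def)
qed

text \<open>The function \<open>g\<close> computes the current position from the vertices chosen so far, the latest
  one first: the latest vertex itself for a walk, a constant for a star.\<close>

fun trail :: "('a list \<Rightarrow> 'a) \<Rightarrow> 'a list \<Rightarrow> 'a set list" where
  "trail g [] = []"
| "trail g (w # xs) = {g xs, w} # trail g xs"

lemma length_trail [simp]: "length (trail g xs) = length xs"
  by (induction xs) auto

text \<open>With \<open>d\<close> distinct entries the weight is \<open>p ^ d * t ^ (length es - 2 * d)\<close>. For \<open>t \<ge> 1\<close> it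
  dominates \<open>p ^ d\<close> when every entry is repeated, but it factorises over the steps of a walk.\<close>

fun weight :: "real \<Rightarrow> real \<Rightarrow> 'e list \<Rightarrow> real" where
  "weight p t [] = 1"
| "weight p t (e # es) = (if e \<in> set es then t else p / t) * weight p t es"

lemma weight_nonneg: "0 \<le> p \<Longrightarrow> 0 \<le> t \<Longrightarrow> 0 \<le> weight p t es"
  by (induction es) auto

lemma weight_eq:
  assumes "t > 0"
  shows "weight p t es * t ^ (2 * card (set es)) = p ^ card (set es) * t ^ length es"
proof (induction es)
  case (Cons e es)
  show ?case
  proof (cases "e \<in> set es")
    case True
    then show ?thesis using Cons by (simp add: insert_absorb mult_ac)
  next
    case False
    have "weight p t (e # es) * t ^ (2 * card (set (e # es)))
        = (p * t) * (weight p t es * t ^ (2 * card (set es)))"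
      using False assms by (simp add: field_simps power2_eq_square)
    also have "\<dots> = p ^ card (set (e # es)) * t ^ length (e # es)"
      unfolding Cons using False by simp
    finally show ?thesis .
  qed
qed simp

lemma weight_ge:
  assumes "t \<ge> 1" "p \<ge> 0" "2 * card (set es) \<le> length es"
  shows "p ^ card (set es) \<le> weight p t es"
proof -
  have "p ^ card (set es) * t ^ (2 * card (set es)) \<le> p ^ card (set es) * t ^ length es"
    using assms by (intro mult_left_mono power_increasing) auto
  also have "\<dots> = weight p t es * t ^ (2 * card (set es))"
    using weight_eq[of t p es] assms by simp
  finally show ?thesis
    using assms by (simp add: mult_le_cancel_right)
qed

text \<open>A step along a new edge has at most \<open>card V\<close> continuations of weight \<open>p / t\<close>, one along an
  old edge has at most \<open>m\<close> continuations of weight \<open>t\<close>.\<close>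

lemma sum_weight_le:
  assumes "finite V" "t > 0" "p \<ge> 0" "j \<le> m"
  shows "(\<Sum>xs\<in>tuples V j. weight p t (trail g xs))
    \<le> (real (card V) * p / t + t * real m) ^ j"
  using \<open>j \<le> m\<close>
proof (induction j)
  case 0
  then show ?case by (simp add: tuples_0)
next
  case (Suc j)
  let ?b = "real (card V) * p / t + t * real m"
  have "(\<Sum>w\<in>V. weight p t (trail g (w # xs))) \<le> ?b * weight p t (trail g xs)"
    if xs: "xs \<in> tuples V j" for xs
  proof -
    let ?W = "{w \<in> V. {g xs, w} \<in> set (trail g xs)}"
    \<comment> \<open>From a fixed position an edge determines its other end, so there is at most
      one continuation per old edge.\<close>
    have "inj_on (\<lambda>w. {g xs, w}) ?W"
      by (auto simp: inj_on_def doubleton_eq_iff)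
    then have "card ?W \<le> card (set (trail g xs))"
      by (rule card_inj_on_le) auto
    also have "\<dots> \<le> m"
      using card_length[of "trail g xs"] xs Suc.prems by (simp add: tuples_def)
    finally have W: "real (card ?W) \<le> real m" by simp
    have "(\<Sum>w\<in>V. if {g xs, w} \<in> set (trail g xs) then t else p / t)
        \<le> (\<Sum>w\<in>V. p / t + (if w \<in> ?W then t else 0))"
      using assms by (intro sum_mono) auto
    also have "\<dots> = real (card V) * p / t + t * real (card ?W)"
      using assms(1) by (simp add: sum.distrib sum.If_cases Int_def mult.commute)
    also have "\<dots> \<le> ?b"
      using W assms by simp
    finally show ?thesis
      using weight_nonneg[of p t "trail g xs"] assms
      by (simp add: sum_distrib_right[symmetric] mult_right_mono)
  qed
  then have "(\<Sum>xs\<in>tuples V (Suc j). weight p t (trail g xs))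
      \<le> (\<Sum>xs\<in>tuples V j. ?b * weight p t (trail g xs))"
    unfolding sum_tuples_Suc by (rule sum_mono)
  also have "\<dots> \<le> ?b * ?b ^ j"
    unfolding sum_distrib_left[symmetric] using Suc assms by (intro mult_left_mono) auto
  finally show ?case by simp
qed

section \<open>Expansion of row sums and matrix powers over stars and walks\<close>

lemma row_sum_power_eq:
  fixes Y :: "'a set \<Rightarrow> real"
  shows "(\<Sum>w\<in>V. Y {u, w}) ^ m = (\<Sum>xs\<in>tuples V m. \<Prod>e\<leftarrow>trail (\<lambda>_. u) xs. Y e)"
proof (induction m)
  case 0
  then show ?case by (simp add: tuples_0)
next
  case (Suc m)
  then show ?case
    by (simp add: sum_tuples_Suc sum_distrib_right[symmetric] sum_distrib_left[symmetric])
qed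

text \<open>The latest vertex comes first in \<open>xs\<close>, so \<open>hd (xs @ [u])\<close> is
  the current position, with \<open>u\<close> as the default before the first step. The
  \<open>of_bool\<close> factor fixes the end point; \<open>v = u\<close> gives closed
  walks.\<close>

lemma mat_power_eq_sum_walks:
  fixes Y :: "'a set \<Rightarrow> real"
  assumes "finite V" "u \<in> V" "v \<in> V"
  shows "mat_power V (\<lambda>u v. Y {u, v}) m u v
    = (\<Sum>xs\<in>tuples V m. of_bool (hd (xs @ [u]) = v) * (\<Prod>e\<leftarrow>trail (\<lambda>xs. hd (xs @ [u])) xs. Y e))"
  using \<open>v \<in> V\<close>
proof (induction m arbitrary: v)
  case 0
  then show ?case by (simp add: tuples_0)
next
  case (Suc m)
  let ?g = "\<lambda>xs. hd (xs @ [u])"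
  let ?P = "\<lambda>xs. \<Prod>e\<leftarrow>trail ?g xs. Y e"
  have g: "?g xs \<in> V" if "xs \<in> tuples V m" for xs
    using that assms by (cases xs) (auto simp: tuples_def)
  have "mat_power V (\<lambda>u v. Y {u, v}) (Suc m) u v
      = (\<Sum>w\<in>V. \<Sum>xs\<in>tuples V m. of_bool (?g xs = w) * ?P xs * Y {w, v})"
    by (simp add: Suc.IH sum_distrib_right)
  also have "\<dots> = (\<Sum>xs\<in>tuples V m. \<Sum>w\<in>V. of_bool (?g xs = w) * ?P xs * Y {w, v})"
    by (rule sum.swap)
  \<comment> \<open>The summation variable changes its meaning: before, \<open>w\<close> is forced
    to be the current position; afterwards, it is the newly chosen vertex, forced to be
    \<open>v\<close>.\<close>
  also have "\<dots> = (\<Sum>xs\<in>tuples V m. \<Sum>w\<in>V. of_bool (w = v) * (Y {?g xs, w} * ?P xs))"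
  proof (rule sum.cong[OF refl])
    fix xs assume xs: "xs \<in> tuples V m"
    have "(\<Sum>w\<in>V. of_bool (?g xs = w) * ?P xs * Y {w, v})
        = (\<Sum>w\<in>V. if ?g xs = w then ?P xs * Y {w, v} else 0)"
      by (intro sum.cong) auto
    also have "\<dots> = ?P xs * Y {?g xs, v}"
      using g[OF xs] assms(1) by simp
    also have "\<dots> = (\<Sum>w\<in>V. if w = v then Y {?g xs, w} * ?P xs else 0)"
      using Suc.prems assms(1) by (simp add: mult.commute)
    also have "\<dots> = (\<Sum>w\<in>V. of_bool (w = v) * (Y {?g xs, w} * ?P xs))"
      by (intro sum.cong) auto
    finally show "(\<Sum>w\<in>V. of_bool (?g xs = w) * ?P xs * Y {w, v})
        = (\<Sum>w\<in>V. of_bool (w = v) * (Y {?g xs, w} * ?P xs))" .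
  qed
  also have "\<dots> = (\<Sum>xs\<in>tuples V (Suc m). of_bool (?g xs = v) * ?P xs)"
    by (simp add: sum_tuples_Suc)
  finally show ?case .
qed

text \<open>Collects repeated edges into powers, so that independence of distinct edges can be
  applied to the product along a trail.\<close>

lemma prod_list_conv_prod_count:
  fixes f :: "'a \<Rightarrow> 'b::comm_monoid_mult"
  shows "(\<Prod>x\<leftarrow>xs. f x) = (\<Prod>x\<in>set xs. f x ^ count_list xs x)"
proof (induction xs)
  case (Cons x xs)
  have "(\<Prod>y\<in>set (x # xs). f y ^ count_list (x # xs) y)
      = (\<Prod>y\<in>set (x # xs). (if y = x then f y else 1) * f y ^ count_list xs y)"
    by (intro prod.cong) auto
  also have "\<dots> = f x * (\<Prod>y\<in>set (x # xs). f y ^ count_list xs y)"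
    by (simp add: prod.distrib del: prod.insert)
  also have "(\<Prod>y\<in>set (x # xs). f y ^ count_list xs y) = (\<Prod>y\<in>set xs. f y ^ count_list xs y)"
    by (intro prod.mono_neutral_right) auto
  finally show ?case by (simp add: Cons.IH)
qed simp

section \<open>Moments of a random graph\<close>

locale kwise_independent_graph =
  fixes N k :: nat and p :: real and G :: "nat set set pmf"
  assumes p: "0 < p" "p < 1"
    and set_pmf_G: "set_pmf G \<subseteq> Pow (potential_edges N)"
    and prob_edge: "e \<in> potential_edges N \<Longrightarrow> measure_pmf.prob G {E. e \<in> E} = p"
    and indep: "S \<subseteq> potential_edges N \<Longrightarrow> card S \<le> k \<Longrightarrow>
      prob_space.indep_vars (measure_pmf G) (\<lambda>_. borel) (\<lambda>e E. indicator E e :: real) S"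
begin

abbreviation V :: "nat set" where "V \<equiv> {1..N}"

text \<open>The value 0 outside the potential edges covers the singletons \<open>{u, u}\<close>: the
  diagonal of the matrix vanishes, and so does the product along any trail with a loop.\<close>

definition centred :: "nat set set \<Rightarrow> nat set \<Rightarrow> real" where
  "centred E e = (if e \<in> potential_edges N then indicator E e - p else 0)"

abbreviation centred_matrix :: "nat set set \<Rightarrow> nat \<Rightarrow> nat \<Rightarrow> real" where
  "centred_matrix E \<equiv> \<lambda>u v. centred E {u, v}"

lemma centred_matrix_symmetric: "centred_matrix E u v = centred_matrix E v u"
  by (simp add: insert_commute)

lemma integrable_G: "integrable (measure_pmf G) (f :: nat set set \<Rightarrow> real)"
proof (rule integrable_measure_pmf_finite)
  have "finite (potential_edges N)"
    unfolding potential_edges_def by (rule finite_subset[of _ "Pow {1..N}"]) auto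
  then show "finite (set_pmf G)"
    using set_pmf_G finite_subset by blast
qed

lemma expectation_edge:
  assumes "e \<in> potential_edges N"
  shows "measure_pmf.expectation G (\<lambda>E. h (indicator E e :: real)) = p * h 1 + (1 - p) * (h 0 :: real)"
proof -
  have "(\<lambda>E. h (indicator E e)) = (\<lambda>E. h 0 + (h 1 - h 0) * indicator {E. e \<in> E} E)"
    by (auto simp: indicator_def fun_eq_iff)
  then show ?thesis
    using prob_edge[OF assms] integrable_G
    by (simp add: algebra_simps)
qed

lemma expectation_centred_power:
  assumes "e \<in> potential_edges N"
  shows "measure_pmf.expectation G (\<lambda>E. centred E e ^ c) = p * (1 - p) ^ c + (1 - p) * (- p) ^ c"
  using expectation_edge[OF assms, of "\<lambda>x. (x - p) ^ c"] assms by (simp add: centred_def)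

text \<open>Centring makes the first moment vanish. For \<open>c \<ge> 2\<close> the two terms are
  at most \<open>p * (1 - p)\<close> and \<open>p ^ 2\<close>, which add up to
  \<open>p\<close>.\<close>

lemma abs_expectation_centred_power_le:
  assumes "e \<in> potential_edges N" "c \<ge> 1"
  shows "\<bar>measure_pmf.expectation G (\<lambda>E. centred E e ^ c)\<bar> \<le> (if c = 1 then 0 else p)"
proof (cases "c = 1")
  case False
  then have "c \<ge> 2" using assms(2) by simp
  have "\<bar>p * (1 - p) ^ c + (1 - p) * (- p) ^ c\<bar> \<le> p * (1 - p) ^ c + (1 - p) * p ^ c"
    using p by (intro order_trans[OF abs_triangle_ineq]) (simp add: abs_mult power_abs)
  also have "\<dots> \<le> p * (1 - p) ^ 1 + 1 * p ^ 2"
    using p \<open>c \<ge> 2\<close> by (intro add_mono mult_mono power_decreasing) auto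
  also have "\<dots> = p" by (simp add: algebra_simps power2_eq_square)
  finally show ?thesis using False expectation_centred_power[OF assms(1)] by simp
qed (use expectation_centred_power[OF assms(1), of 1] in \<open>simp add: algebra_simps\<close>)

text \<open>A factor occurring only once has mean zero and independence makes the expectation vanish;
  otherwise there are at most \<open>length es / 2\<close> distinct factors.\<close>

lemma abs_expectation_prod_le_weight:
  assumes "length es \<le> k" "t \<ge> 1"
  shows "\<bar>measure_pmf.expectation G (\<lambda>E. \<Prod>e\<leftarrow>es. centred E e)\<bar> \<le> weight p t es"
proof (cases "set es \<subseteq> potential_edges N")
  case False
  then have "(\<Prod>e\<leftarrow>es. centred E e) = 0" for E
    by (auto simp: prod_list_zero_iff centred_def image_iff)
  then show ?thesis using weight_nonneg[of p t es] p assms by simp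
next
  case True
  let ?Exp = "measure_pmf.expectation G"
  let ?c = "count_list es"
  have c: "?c e \<ge> 1" if "e \<in> set es" for e
    using that count_list_0_iff[of es e] by linarith
  \<comment> \<open>Independence is applied to the distinct edges, of which there are at most
    \<open>length es \<le> k\<close>.\<close>
  have "prob_space.indep_vars (measure_pmf G) (\<lambda>_. borel) (\<lambda>e E. indicator E e :: real) (set es)"
    using True assms(1) card_length[of es] by (intro indep) auto
  then have "prob_space.indep_vars (measure_pmf G) (\<lambda>_. borel)
      (\<lambda>e E. (indicator E e - p) ^ ?c e) (set es)"
    by (rule prob_space.indep_vars_compose2[OF prob_space_measure_pmf,
          where Y = "\<lambda>e x. (x - p) ^ ?c e"]) simp
  then have "?Exp (\<lambda>E. \<Prod>e\<in>set es. (indicator E e - p) ^ ?c e)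
      = (\<Prod>e\<in>set es. ?Exp (\<lambda>E. (indicator E e - p) ^ ?c e))"
    by (intro prob_space.indep_vars_lebesgue_integral[OF prob_space_measure_pmf] integrable_G) auto
  moreover have "centred E e = indicator E e - p" if "e \<in> set es" for E e
    using that True by (auto simp: centred_def)
  ultimately have eq: "?Exp (\<lambda>E. \<Prod>e\<leftarrow>es. centred E e) = (\<Prod>e\<in>set es. ?Exp (\<lambda>E. centred E e ^ ?c e))"
    by (simp add: prod_list_conv_prod_count cong: prod.cong)
  have "\<bar>?Exp (\<lambda>E. \<Prod>e\<leftarrow>es. centred E e)\<bar> \<le> (\<Prod>e\<in>set es. if ?c e = 1 then 0 else p)"
    unfolding eq abs_prod using True c
    by (intro prod_mono conjI abs_expectation_centred_power_le abs_ge_zero) auto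
  also have "\<dots> \<le> weight p t es"
  proof (cases "\<exists>e\<in>set es. ?c e = 1")
    case True
    then have "(\<Prod>e\<in>set es. if ?c e = 1 then 0 else p) = 0"
      by (intro prod_zero) auto
    then show ?thesis using weight_nonneg[of p t es] p assms by (simp only:)
  next
    case False
    have "2 * card (set es) = (\<Sum>e\<in>set es. 2)" by simp
    also have "\<dots> \<le> (\<Sum>e\<in>set es. ?c e)"
      using False c by (intro sum_mono) (metis One_nat_def Suc_1 Suc_leI le_neq_implies_less)
    also have "\<dots> = length es" by (intro sum_count_set) auto
    finally have "p ^ card (set es) \<le> weight p t es"
      using p assms by (intro weight_ge) auto
    moreover have "(\<Prod>e\<in>set es. if ?c e = 1 then 0 else p) = (\<Prod>e\<in>set es. p)"
      using False by (intro prod.cong) auto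
    ultimately show ?thesis by simp
  qed
  finally show ?thesis .
qed

text \<open>As \<open>g\<close> is arbitrary, one bound serves both stars and walks.\<close>

lemma sum_abs_expectation_trail_le:
  assumes "1 \<le> m" "m \<le> k" "real m \<le> real N * p"
  shows "(\<Sum>xs\<in>tuples V m. \<bar>measure_pmf.expectation G (\<lambda>E. \<Prod>e\<leftarrow>trail g xs. centred E e)\<bar>)
    \<le> (2 * sqrt (real N * p * real m)) ^ m"
proof -
  \<comment> \<open>This \<open>t\<close> balances new and old edges in
    \<open>sum_weight_le\<close>: both terms become \<open>sqrt (N p m)\<close>. The hypothesis
    \<open>m \<le> N p\<close> is what makes \<open>t \<ge> 1\<close>.\<close>
  define t where "t = sqrt (real N * p / real m)"
  have t: "t \<ge> 1" using assms by (simp add: t_def)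
  have "real N * p = real m * t\<^sup>2"
    using p assms by (simp add: t_def)
  moreover have tm: "t * real m = sqrt (real N * p * real m)"
  proof -
    have "t * real m = sqrt (real N * p / real m * (real m)\<^sup>2)"
      by (simp only: t_def real_sqrt_mult[of _ "(real m)\<^sup>2"] real_sqrt_abs abs_of_nat)
    also have "real N * p / real m * (real m)\<^sup>2 = real N * p * real m"
      using assms by (simp add: power2_eq_square)
    finally show ?thesis .
  qed
  ultimately have b: "real (card V) * p / t + t * real m = 2 * sqrt (real N * p * real m)"
    using t by (simp add: power2_eq_square mult_ac)
  have "(\<Sum>xs\<in>tuples V m. \<bar>measure_pmf.expectation G (\<lambda>E. \<Prod>e\<leftarrow>trail g xs. centred E e)\<bar>)
      \<le> (\<Sum>xs\<in>tuples V m. weight p t (trail g xs))"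
    using assms t by (intro sum_mono abs_expectation_prod_le_weight) (auto simp: tuples_def)
  also have "\<dots> \<le> (2 * sqrt (real N * p * real m)) ^ m"
    unfolding b[symmetric] using p t by (intro sum_weight_le) auto
  finally show ?thesis .
qed

lemma expectation_row_sum_power_le:
  assumes "1 \<le> m" "m \<le> k" "real m \<le> real N * p"
  shows "measure_pmf.expectation G (\<lambda>E. (\<Sum>w\<in>V. centred_matrix E u w) ^ m)
    \<le> (2 * sqrt (real N * p * real m)) ^ m"
proof -
  have "measure_pmf.expectation G (\<lambda>E. (\<Sum>w\<in>V. centred_matrix E u w) ^ m)
      = (\<Sum>xs\<in>tuples V m. measure_pmf.expectation G (\<lambda>E. \<Prod>e\<leftarrow>trail (\<lambda>_. u) xs. centred E e))"
    unfolding row_sum_power_eq by (intro Bochner_Integration.integral_sum integrable_G)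
  also have "\<dots> \<le> (\<Sum>xs\<in>tuples V m.
      \<bar>measure_pmf.expectation G (\<lambda>E. \<Prod>e\<leftarrow>trail (\<lambda>_. u) xs. centred E e)\<bar>)"
    by (intro sum_mono abs_ge_self)
  finally show ?thesis
    using sum_abs_expectation_trail_le[OF assms, of "\<lambda>_. u"] by linarith
qed

lemma expectation_mat_power_le:
  assumes "1 \<le> m" "m \<le> k" "real m \<le> real N * p" "u \<in> V"
  shows "measure_pmf.expectation G (\<lambda>E. mat_power V (centred_matrix E) m u u)
    \<le> (2 * sqrt (real N * p * real m)) ^ m"
proof -
  let ?g = "\<lambda>xs. hd (xs @ [u])"
  have "measure_pmf.expectation G (\<lambda>E. mat_power V (centred_matrix E) m u u)
      = (\<Sum>xs\<in>tuples V m. of_bool (?g xs = u) *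
          measure_pmf.expectation G (\<lambda>E. \<Prod>e\<leftarrow>trail ?g xs. centred E e))"
    using assms(4)
    by (simp add: mat_power_eq_sum_walks Bochner_Integration.integral_sum integrable_G)
  \<comment> \<open>The condition that the walk closes up is dropped, which is possible after
    passing to absolute values.\<close>
  also have "\<dots> \<le> (\<Sum>xs\<in>tuples V m.
      \<bar>measure_pmf.expectation G (\<lambda>E. \<Prod>e\<leftarrow>trail ?g xs. centred E e)\<bar>)"
    by (intro sum_mono) auto
  finally show ?thesis
    using sum_abs_expectation_trail_le[OF assms(1-3), of ?g] by linarith
qed

section \<open>Disconnected graphs and their probability\<close>

text \<open>The vertices reachable from \<open>u\<close> and their complement are both closed under
  edges and nonempty if \<open>v\<close> is not reachable; the smaller of the two has at most
  \<open>N / 2\<close> elements.\<close>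

lemma disconnected_obtains_closed_set:
  assumes "E \<subseteq> potential_edges N" "\<not> connected_graph N E"
  obtains S where "S \<subseteq> V" "S \<noteq> {}" "2 * card S \<le> N" "\<And>x y. x \<in> S \<Longrightarrow> {x, y} \<in> E \<Longrightarrow> y \<in> S"
proof -
  let ?R = "{(x, y). {x, y} \<in> E}"
  obtain u v where uv: "u \<in> V" "v \<in> V" "(u, v) \<notin> ?R\<^sup>*"
    using assms(2) by (auto simp: connected_graph_def)
  define C where "C = {x \<in> V. (u, x) \<in> ?R\<^sup>*}"
  have V: "x \<in> V" if "{x, y} \<in> E" for x y
    using that assms(1) by (auto simp: potential_edges_def)
  have closed: "y \<in> C" if "x \<in> C" "{x, y} \<in> E" for x y
  proof -
    have "(x, y) \<in> ?R" "(u, x) \<in> ?R\<^sup>*" using that by (auto simp: C_def)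
    then have "(u, y) \<in> ?R\<^sup>*" by (rule rtrancl_into_rtrancl[rotated])
    moreover have "y \<in> V" using V[of y x] that(2) by (simp add: insert_commute)
    ultimately show ?thesis by (simp add: C_def)
  qed
  have CV: "C \<subseteq> V" "u \<in> C" "v \<in> V - C"
    using uv by (auto simp: C_def)
  show ?thesis
  proof (cases "2 * card C \<le> N")
    case True
    show ?thesis by (rule that[of C]) (use CV closed True in blast)+
  next
    case False
    have "card (V - C) = N - card C"
      using CV(1) by (simp add: card_Diff_subset finite_subset)
    then have "2 * card (V - C) \<le> N" using False by simp
    moreover have "y \<in> V - C" if "x \<in> V - C" "{x, y} \<in> E" for x y
      using that closed[of y x] V[of y x] by (metis DiffD1 DiffD2 DiffI insert_commute)
    ultimately show ?thesis using CV by (intro that[of "V - C"]) blast+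
  qed
qed

text \<open>Both sums are nonnegative, as the exponent is a power of two and even, so it suffices
  that one of them reaches the bound.\<close>

lemma disconnected_large_moments:
  fixes r :: nat
  assumes E: "E \<subseteq> potential_edges N" "\<not> connected_graph N E"
  defines "m \<equiv> 2 ^ Suc r :: nat"
  shows "(real N * p / 4) ^ m \<le> (\<Sum>u\<in>V. (\<Sum>w\<in>V. centred_matrix E u w) ^ m)
    + (\<Sum>u\<in>V. mat_power V (centred_matrix E) m u u)"
proof -
  let ?T = "real N * p / 4" and ?D = "\<lambda>u. \<Sum>w\<in>V. centred_matrix E u w"
  have even: "even m" by (simp add: m_def)
  have T: "?T \<ge> 0" using p by simp
  have nonneg: "0 \<le> (\<Sum>u\<in>V. mat_power V (centred_matrix E) m u u)"
    unfolding m_def by (intro trace_mat_power_nonneg centred_matrix_symmetric) simp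
  show ?thesis
  proof (cases "\<exists>u\<in>V. ?D u < - ?T")
    case True
    then obtain u where u: "u \<in> V" "?D u < - ?T" by blast
    have "?T ^ m \<le> (- ?D u) ^ m" using u T by (intro power_mono) auto
    also have "\<dots> = ?D u ^ m" using even by simp
    also have "\<dots> \<le> (\<Sum>u\<in>V. ?D u ^ m)"
      using u even by (intro member_le_sum zero_le_even_power) auto
    finally show ?thesis using nonneg by linarith
  next
    case False
    obtain S where S: "S \<subseteq> V" "S \<noteq> {}" "2 * card S \<le> N"
      "\<And>x y. x \<in> S \<Longrightarrow> {x, y} \<in> E \<Longrightarrow> y \<in> S"
      using disconnected_obtains_closed_set[OF E] by blast
    have fin: "finite S" using S(1) finite_subset by blast
    \<comment> \<open>At least \<open>N / 2\<close> entries of the row lie outside \<open>S\<close>,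
      and each equals \<open>- p\<close> as no edge leaves \<open>S\<close>. They contribute at most
      \<open>- N p / 2\<close>, but the whole row sum is at least \<open>- N p / 4\<close>, so the
      part inside \<open>S\<close> is at least \<open>N p / 4\<close>.\<close>
    have row: "?T \<le> (\<Sum>w\<in>S. centred_matrix E u w)" if u: "u \<in> S" for u
    proof -
      have "centred_matrix E u w = - p" if w: "w \<in> V - S" for w
      proof -
        have "{u, w} \<in> potential_edges N" "{u, w} \<notin> E"
          using u w S by (auto simp: potential_edges_def card_insert_if)
        then show ?thesis by (simp add: centred_def)
      qed
      then have "?D u = (\<Sum>w\<in>S. centred_matrix E u w) - p * real (card (V - S))"
        using sum.subset_diff[OF S(1), of "centred_matrix E u"] by simp
      moreover have "real (card (V - S)) \<ge> real N / 2"
        using S fin by (simp add: card_Diff_subset)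
      then have "p * real (card (V - S)) \<ge> p * (real N / 2)"
        using p by (intro mult_left_mono) auto
      moreover have "?D u \<ge> - ?T" using False u S(1) by force
      ultimately show ?thesis by (simp add: mult.commute)
    qed
    let ?x = "indicator S :: nat \<Rightarrow> real"
    have restrict: "(\<Sum>u\<in>V. ?x u * f u) = sum f S" for f
      using S(1) by (simp add: sum.mono_neutral_cong_right indicator_def if_distrib sum.If_cases Int_absorb1)
    have "quad_form V (centred_matrix E) ?x = (\<Sum>u\<in>V. ?x u * (\<Sum>v\<in>V. ?x v * centred_matrix E u v))"
      unfolding quad_form_def sum_distrib_left by (intro sum.cong refl) (simp only: mult_ac)
    then have "quad_form V (centred_matrix E) ?x = (\<Sum>u\<in>S. \<Sum>v\<in>S. centred_matrix E u v)"
      unfolding restrict .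
    moreover have "real (card S) * ?T \<le> (\<Sum>u\<in>S. \<Sum>v\<in>S. centred_matrix E u v)"
      using row by (rule sum_bounded_below)
    ultimately have "(real (card S) * ?T) ^ m \<le> quad_form V (centred_matrix E) ?x ^ m"
      using T by (intro power_mono) auto
    also have "\<dots> \<le> (\<Sum>u\<in>V. (?x u)\<^sup>2) ^ m * (\<Sum>u\<in>V. mat_power V (centred_matrix E) m u u)"
      unfolding m_def by (intro quad_form_power_le_trace centred_matrix_symmetric)
    also have "(\<Sum>u\<in>V. (?x u)\<^sup>2) = real (card S)"
      using restrict[of ?x] restrict[of "\<lambda>_. 1"] by (simp add: power2_eq_square)
    finally have "real (card S) ^ m * ?T ^ m
        \<le> real (card S) ^ m * (\<Sum>u\<in>V. mat_power V (centred_matrix E) m u u)"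
      by (simp only: power_mult_distrib)
    moreover have "real (card S) ^ m > 0"
      using S(2) fin by (simp add: card_gt_0_iff)
    ultimately have "?T ^ m \<le> (\<Sum>u\<in>V. mat_power V (centred_matrix E) m u u)"
      by (simp only: mult_le_cancel_left_pos)
    moreover have "0 \<le> (\<Sum>u\<in>V. ?D u ^ m)"
      using even by (intro sum_nonneg zero_le_even_power)
    ultimately show ?thesis by linarith
  qed
qed

lemma prob_disconnected_le:
  assumes "2 ^ Suc r \<le> k" "2 ^ Suc r \<le> real N * p"
  shows "measure_pmf.prob G {E. \<not> connected_graph N E}
    \<le> 2 * real N * (64 * 2 ^ Suc r / (real N * p)) ^ 2 ^ r"
proof -
  define m :: nat where "m = 2 ^ Suc r"
  have m: "1 \<le> m" "m \<le> k" "real m \<le> real N * p" "even m"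
    using assms by (auto simp: m_def)
  have Np: "real N * p > 0" using m by linarith
  let ?T = "real N * p / 4" and ?B = "(2 * sqrt (real N * p * real m)) ^ m"
  let ?D = "\<lambda>E. \<Sum>u\<in>V. (\<Sum>w\<in>V. centred_matrix E u w) ^ m"
  let ?W = "\<lambda>E. \<Sum>u\<in>V. mat_power V (centred_matrix E) m u u"
  have nonneg: "0 \<le> ?D E + ?W E" for E
    unfolding m_def by (intro add_nonneg_nonneg trace_mat_power_nonneg centred_matrix_symmetric
        sum_nonneg zero_le_even_power) auto
  \<comment> \<open>Only graphs in the support are known to consist of potential edges, which
    \<open>disconnected_large_moments\<close> requires.\<close>
  have "measure_pmf.prob G {E. \<not> connected_graph N E}
      = measure_pmf.prob G ({E. \<not> connected_graph N E} \<inter> set_pmf G)"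
    by (simp add: measure_Int_set_pmf)
  also have "\<dots> \<le> measure_pmf.prob G {E \<in> space (measure_pmf G). ?D E + ?W E \<ge> ?T ^ m}"
    unfolding m_def using set_pmf_G disconnected_large_moments
    by (intro measure_pmf.finite_measure_mono) auto
  also have "\<dots> \<le> measure_pmf.expectation G (\<lambda>E. ?D E + ?W E) / ?T ^ m"
    using nonneg Np by (intro integral_Markov_inequality_measure[where A = "{}"] integrable_G) auto
  also have "measure_pmf.expectation G (\<lambda>E. ?D E + ?W E)
      = (\<Sum>u\<in>V. measure_pmf.expectation G (\<lambda>E. (\<Sum>w\<in>V. centred_matrix E u w) ^ m))
        + (\<Sum>u\<in>V. measure_pmf.expectation G (\<lambda>E. mat_power V (centred_matrix E) m u u))"
    by (simp only: Bochner_Integration.integral_add Bochner_Integration.integral_sum integrable_G)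
  also have "\<dots> \<le> (\<Sum>u\<in>V. ?B) + (\<Sum>u\<in>V. ?B)"
    using m by (intro add_mono sum_mono expectation_row_sum_power_le expectation_mat_power_le) auto
  also have "\<dots> = 2 * real N * ?B" by simp
  also have "2 * real N * ?B / ?T ^ m = 2 * real N * (2 * sqrt (real N * p * real m) / ?T) ^ m"
    by (simp only: power_divide times_divide_eq_right)
  \<comment> \<open>As \<open>m = 2 * 2 ^ r\<close>, pairing the factors removes the square root:
    \<open>2 sqrt (N p m) / (N p / 4)\<close> has the square \<open>64 m / (N p)\<close>.\<close>
  also have "(2 * sqrt (real N * p * real m) / ?T) ^ m = ((2 * sqrt (real N * p * real m) / ?T)\<^sup>2) ^ 2 ^ r"
    by (simp add: m_def power_mult[symmetric])
  also have "(2 * sqrt (real N * p * real m) / ?T)\<^sup>2 = 64 * real m / (real N * p)"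
  proof -
    have "(2 * sqrt (real N * p * real m) / ?T)\<^sup>2 = 4 * (real N * p * real m) / ?T\<^sup>2"
      using p by (simp add: power_divide power_mult_distrib)
    also have "\<dots> = 64 * real m / (real N * p)"
      using Np by (simp add: field_simps power2_eq_square)
    finally show ?thesis .
  qed
  finally show ?thesis
    using Np by (simp add: m_def divide_right_mono)
qed

end

section \<open>The two density regimes\<close>

lemma kwise_independent_graph_of_random_graph:
  assumes "kwise_independent_random_graph k p \<G>" "p N \<in> {0<..<1}"
  shows "kwise_independent_graph N (k N) (p N) (\<G> N)"
  using assms unfolding kwise_independent_random_graph_def kwise_independent_graph_def by auto

lemma ex_power_of_two_between:
  fixes x :: real
  assumes "x \<ge> 1"
  obtains n :: nat where "2 ^ n \<le> x" "x < 2 ^ Suc n"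
proof -
  have "log 2 x \<ge> 0" using assms by simp
  then have "real (nat \<lfloor>log 2 x\<rfloor>) \<le> log 2 x" "log 2 x < real (Suc (nat \<lfloor>log 2 x\<rfloor>))"
    by linarith+
  then obtain n :: nat where n: "real n \<le> log 2 x" "log 2 x < real (Suc n)" by blast
  have "2 powr real n \<le> x"
    using n(1) assms by (subst (asm) le_log_iff) auto
  moreover have "x < 2 powr real (Suc n)"
    using n(2) assms by (subst (asm) log_less_iff) auto
  ultimately show ?thesis
    using that[of n] by (simp only: powr_realpow)
qed

text \<open>With \<open>L = log 2 N\<close>, a power of two \<open>m\<close> satisfies
  \<open>2 L < m \<le> 4 L \<le> 8 ln N\<close>. The constant \<open>2048 = 256 * 8\<close> gives
  \<open>256 m \<le> N p\<close>, so the base \<open>64 m / (N p)\<close> is at most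
  \<open>1 / 4\<close>. Its power \<open>(1 / 4) ^ (m / 2) = 2 powr - m\<close> is below
  \<open>1 / N ^ 2\<close>, which beats the factor \<open>2 N\<close>.\<close>

lemma prob_disconnected_le_of_log_independence:
  assumes G: "kwise_independent_graph N k p G"
    and k: "real k \<ge> 4 * log 2 (real N)" and dense: "p \<ge> 2048 * ln (real N) / real N" and N: "N \<ge> 2"
  shows "measure_pmf.prob G {E. \<not> connected_graph N E} \<le> 2 / real N"
proof -
  interpret kwise_independent_graph N k p G by (fact G)
  let ?L = "log 2 (real N)"
  have L: "?L \<ge> 1" using N by simp
  then obtain r where r: "2 ^ r \<le> 2 * ?L" "2 * ?L < 2 ^ Suc r"
    using ex_power_of_two_between[of "2 * ?L"] by auto
  let ?m = "2 ^ Suc r :: real"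
  have "ln 2 * ?L = ln (real N)" by (simp add: log_def)
  moreover have "1 / 2 * ?L \<le> ln 2 * ?L"
    using ln2_ge_two_thirds L by (intro mult_right_mono) auto
  ultimately have "?m \<le> 8 * ln (real N)" using r by simp
  moreover have "2048 * ln (real N) \<le> real N * p"
    using dense N by (simp add: divide_le_eq mult.commute)
  ultimately have Np: "256 * ?m \<le> real N * p" by linarith
  have m: "?m > 0" by simp
  have "real (2 ^ Suc r) \<le> real k" using r k by simp
  then have "2 ^ Suc r \<le> k" by (simp only: of_nat_le_iff)
  moreover have "?m \<le> real N * p" using Np m by linarith
  ultimately have "measure_pmf.prob G {E. \<not> connected_graph N E}
      \<le> 2 * real N * (64 * 2 ^ Suc r / (real N * p)) ^ 2 ^ r"
    by (rule prob_disconnected_le)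
  also have "\<dots> \<le> 2 * real N * (1 / 4) ^ 2 ^ r"
  proof (intro mult_left_mono power_mono)
    show "64 * 2 ^ Suc r / (real N * p) \<le> 1 / 4"
      using Np m by (subst pos_divide_le_eq) linarith+
    show "0 \<le> 64 * 2 ^ Suc r / (real N * p)"
      using Np m by (intro divide_nonneg_nonneg) linarith+
  qed auto
  also have "(1 / 4 :: real) ^ 2 ^ r = 2 powr - ?m"
  proof -
    have "(1 / 4 :: real) = 2 powr - 2" by (simp add: powr_minus)
    then have "(1 / 4 :: real) ^ 2 ^ r = 2 powr (- 2 * real (2 ^ r))"
      by (simp only: powr_power mult.commute)
    then show ?thesis by simp
  qed
  also have "2 * real N * 2 powr - ?m \<le> 2 * real N * 2 powr (- (2 * ?L))"
    using r(2) by (intro mult_left_mono powr_mono) auto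
  also have "2 powr (- (2 * ?L)) = 1 / (real N)\<^sup>2"
  proof -
    have "2 powr (- (2 * ?L)) = (2 powr ?L) powr - 2"
      by (simp add: powr_powr mult.commute)
    also have "\<dots> = real N powr - 2" using N by simp
    finally show ?thesis using N by (simp add: powr_minus divide_inverse)
  qed
  also have "2 * real N * (1 / (real N)\<^sup>2) = 2 / real N"
    using N by (simp add: power2_eq_square)
  finally show ?thesis .
qed

text \<open>The case \<open>m = 4\<close>: \<open>2 N (256 / (N p)) ^ 2\<close> equals
  \<open>131072 / (N p ^ 2)\<close>, which tends to 0 exactly when \<open>p sqrt N\<close> tends to
  infinity.\<close>

lemma prob_disconnected_le_of_four_independence:
  assumes G: "kwise_independent_graph N k p G" and k: "k \<ge> 4" and dense: "p * sqrt (real N) \<ge> 4"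
  shows "measure_pmf.prob G {E. \<not> connected_graph N E} \<le> 131072 / (p * sqrt (real N)) ^ 2"
proof -
  interpret kwise_independent_graph N k p G by (fact G)
  \<comment> \<open>For \<open>N = 0\<close> the left side of \<open>dense\<close> would be
    0.\<close>
  have N: "N \<ge> 1" using dense by (cases N) auto
  have "real N * p = sqrt (real N) * (p * sqrt (real N))" by simp
  moreover have "1 * (p * sqrt (real N)) \<le> sqrt (real N) * (p * sqrt (real N))"
    using N dense by (intro mult_right_mono) auto
  ultimately have "4 \<le> real N * p" using dense by linarith
  then have "measure_pmf.prob G {E. \<not> connected_graph N E}
      \<le> 2 * real N * (64 * 2 ^ Suc 1 / (real N * p)) ^ 2 ^ 1"
    using k by (intro prob_disconnected_le) auto
  also have "\<dots> = 131072 / (p * sqrt (real N)) ^ 2"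
    using N by (simp add: power_mult_distrib power_divide field_simps power2_eq_square)
  finally show ?thesis .
qed

theorem mainTheorem2:
  "\<exists>c>0. \<forall>(k :: nat \<Rightarrow> nat) (p :: nat \<Rightarrow> real) (\<G> :: nat \<Rightarrow> nat set set pmf).
     (\<forall>N. p N \<in> {0<..<1}) \<longrightarrow>
     kwise_independent_random_graph k p \<G> \<longrightarrow>
     ((\<forall>\<^sub>F N in sequentially. k N \<ge> 4) \<and>
        filterlim (\<lambda>N. p N * sqrt (real N)) at_top sequentially) \<or>
     ((\<forall>\<^sub>F N in sequentially. real (k N) \<ge> 4 * log 2 (real N)) \<and>
        (\<forall>\<^sub>F N in sequentially. p N \<ge> c * ln (real N) / real N)) \<longrightarrow>
     (\<lambda>N. measure_pmf.prob (\<G> N) {E. connected_graph N E}) \<longlonglongrightarrow> 1"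
proof (intro exI[of _ 2048] conjI allI impI)
  fix k :: "nat \<Rightarrow> nat" and p :: "nat \<Rightarrow> real" and \<G> :: "nat \<Rightarrow> nat set set pmf"
  assume p: "\<forall>N. p N \<in> {0<..<1}" and \<G>: "kwise_independent_random_graph k p \<G>"
    and cases: "((\<forall>\<^sub>F N in sequentially. k N \<ge> 4) \<and>
        filterlim (\<lambda>N. p N * sqrt (real N)) at_top sequentially) \<or>
     ((\<forall>\<^sub>F N in sequentially. real (k N) \<ge> 4 * log 2 (real N)) \<and>
        (\<forall>\<^sub>F N in sequentially. p N \<ge> 2048 * ln (real N) / real N))"
  let ?b = "\<lambda>N. measure_pmf.prob (\<G> N) {E. \<not> connected_graph N E}"
  have graph: "kwise_independent_graph N (k N) (p N) (\<G> N)" for N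
    using kwise_independent_graph_of_random_graph[OF \<G>] p by blast
  have "?b \<longlonglongrightarrow> 0"
    using cases
  proof (elim disjE conjE)
    assume k: "\<forall>\<^sub>F N in sequentially. k N \<ge> 4"
      and lim: "filterlim (\<lambda>N. p N * sqrt (real N)) at_top sequentially"
    have "\<forall>\<^sub>F N in sequentially. p N * sqrt (real N) \<ge> 4"
      using lim by (simp add: filterlim_at_top)
    with k have "\<forall>\<^sub>F N in sequentially. norm (?b N) \<le> 131072 / (p N * sqrt (real N)) ^ 2"
      by eventually_elim (simp add: prob_disconnected_le_of_four_independence[OF graph])
    moreover have "(\<lambda>N. 131072 / (p N * sqrt (real N)) ^ 2) \<longlonglongrightarrow> 0"
      by (intro tendsto_divide_0[OF tendsto_const] filterlim_at_top_imp_at_infinity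
          filterlim_pow_at_top lim) simp
    ultimately show ?thesis
      by (rule Lim_null_comparison)
  next
    assume k: "\<forall>\<^sub>F N in sequentially. real (k N) \<ge> 4 * log 2 (real N)"
      and p: "\<forall>\<^sub>F N in sequentially. p N \<ge> 2048 * ln (real N) / real N"
    \<comment> \<open>From \<open>N = 2\<close> on, \<open>log 2 N\<close> is at least 1, as the
      choice of the power of two requires.\<close>
    from k p eventually_ge_at_top[of 2] have "\<forall>\<^sub>F N in sequentially. norm (?b N) \<le> 2 / real N"
      by eventually_elim (simp add: prob_disconnected_le_of_log_independence[OF graph])
    moreover have "(\<lambda>N. 2 / real N) \<longlonglongrightarrow> 0"
      by (rule lim_const_over_n)
    ultimately show ?thesis
      by (rule Lim_null_comparison)
  qed
  then have "(\<lambda>N. 1 - ?b N) \<longlonglongrightarrow> 1 - 0"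
    by (intro tendsto_intros)
  moreover have "measure_pmf.prob (\<G> N) {E. connected_graph N E} = 1 - ?b N" for N
  proof -
    have "{E. connected_graph N E} = space (measure_pmf (\<G> N)) - {E. \<not> connected_graph N E}"
      by auto
    then show ?thesis by (simp only:) (rule measure_pmf.prob_compl, simp)
  qed
  ultimately show "(\<lambda>N. measure_pmf.prob (\<G> N) {E. connected_graph N E}) \<longlonglongrightarrow> 1"
    by simp
qed simp

end
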